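(* Let $\varphi$ be an automorphism of $B_N$. Then there is a semigroup $\{\varphi_t\}$ of automorphisms of $B_N$ such that $\varphi_1=\varphi$.
   Context: $B_N$ is the open unit ball of $\mathbb{C}^N$; an automorphism is a biholomorphic self-map. A (continuous) semigroup $\{\varphi_t\}_{t\ge0}$ on a domain $D$ is a continuous homomorphism from the additive semigroup of non-negative reals into the composition semigroup of holomorphic self-maps of $D$ with the compact-open topology (so $\varphi_0=\mathrm{id}$, $\varphi_{t+s}=\varphi_t\circ\varphi_s$). *)

theory Defs
  imports "HOL-Analysis.Analysis"
begin

text \<open>
  Maps between subsets of complex Euclidean spaces are total functions of which only the
  restriction to the set under consideration matters.  The norm on \<^typ>\<open>complex ^ 'n\<close> is the
  Euclidean one, so \<^term>\<open>ball 0 1 :: (complex ^ 'n) set\<close> is the open unit ball of complex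
  \<open>N\<close>-space, with \<open>N = CARD('n)\<close>.
\<close>

text \<open>Used for open sets \<open>D\<close> only: the Frechet derivative exists and is complex-linear.\<close>

definition holomorphic_map_on ::
    "(complex ^ 'n \<Rightarrow> complex ^ 'm) \<Rightarrow> (complex ^ 'n) set \<Rightarrow> bool" where
  "holomorphic_map_on f D \<longleftrightarrow>
     (\<forall>z\<in>D. \<exists>f'. Vector_Spaces.linear (*s) (*s) f' \<and> (f has_derivative f') (at z))"

definition holomorphic_self_maps :: "(complex ^ 'n) set \<Rightarrow> (complex ^ 'n \<Rightarrow> complex ^ 'n) set" where
  "holomorphic_self_maps D = {f. holomorphic_map_on f D \<and> f ` D \<subseteq> D}"

definition holomorphic_automorphism :: "(complex ^ 'n) set \<Rightarrow> (complex ^ 'n \<Rightarrow> complex ^ 'n) \<Rightarrow> bool" where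
  "holomorphic_automorphism D f \<longleftrightarrow>
     holomorphic_map_on f D \<and> bij_betw f D D \<and> holomorphic_map_on (inv_into D f) D"

text \<open>
  The sets for \<open>K = {}\<close> make the space of all continuous maps from \<open>D\<close> to \<open>E\<close> the underlying
  space.  Relatively open subsets of \<open>E\<close> and open sets \<open>U\<close> give the same subbasis, since the
  maps take values in \<open>E\<close> on \<open>D\<close>.
\<close>

definition compact_open_topology ::
    "'a::topological_space set \<Rightarrow> 'b::topological_space set \<Rightarrow> ('a \<Rightarrow> 'b) topology" where
  "compact_open_topology D E =
     topology_generated_by
       {{f. continuous_on D f \<and> f ` D \<subseteq> E \<and> f ` K \<subseteq> U} | K U. compact K \<and> K \<subseteq> D \<and> open U}"

text \<open>The values of \<open>\<phi>\<close> at negative parameters are irrelevant.\<close>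

definition holomorphic_semigroup ::
    "(complex ^ 'n) set \<Rightarrow> (real \<Rightarrow> complex ^ 'n \<Rightarrow> complex ^ 'n) \<Rightarrow> bool" where
  "holomorphic_semigroup D \<phi> \<longleftrightarrow>
     (\<forall>t\<ge>0. \<phi> t \<in> holomorphic_self_maps D) \<and>
     (\<forall>z\<in>D. \<phi> 0 z = z) \<and>
     (\<forall>s\<ge>0. \<forall>t\<ge>0. \<forall>z\<in>D. \<phi> (t + s) z = \<phi> t (\<phi> s z)) \<and>
     continuous_map (top_of_set {0..})
       (subtopology (compact_open_topology D D) (holomorphic_self_maps D)) \<phi>"

end

theory Submission
  imports
    Defs
    "HOL-Complex_Analysis.Conformal_Mappings"
    "HOL-Computational_Algebra.Fundamental_Theorem_Algebra"
begin

text \<open>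
  Every automorphism of the ball is the projective action of a matrix \<open>M\<close> preserving the Lorentz
  form of signature \<open>(1, N)\<close>: composing with a Moebius involution we may assume that it fixes the
  origin, and then the Schwarz lemma on complex lines shows that it is a linear isometry.
  The entries of \<open>M ^ n\<close> satisfy linear recurrences, hence are sums of terms \<open>l ^ n * p n\<close> with
  \<open>l \<noteq> 0\<close>.  Interpolating with the principal value of \<open>l ^ t\<close> defines \<open>M ^ t\<close> for real \<open>t\<close>.
  Such interpolations are determined by their values at the natural numbers, so all identities
  between entries carry over from natural to real exponents: \<open>M ^ (s + t) = M ^ s M ^ t\<close>, and
  \<open>M ^ (- t)\<close> is the adjoint of \<open>M ^ t\<close> for the Lorentz form.
\<close>

section \<open>Interpolation by exponential polynomials\<close>

abbreviation shift_poly :: "complex poly \<Rightarrow> complex poly" where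
  "shift_poly q \<equiv> pcompose q [:1, 1:]"

lemma degree_shift_poly [simp]: "degree (shift_poly q) = degree q"
  by (simp add: degree_pcompose)

lemma lead_coeff_shift_poly: "coeff (shift_poly q) (degree q) = lead_coeff q"
  using lead_coeff_comp[of "[:1, 1::complex:]" q] by simp

text \<open>The leading terms cancel. This drop in degree drives the inductions below.\<close>

lemma shift_poly_diff_degree:
  assumes "shift_poly q - q \<noteq> 0"
  shows "degree (shift_poly q - q) < degree q"
proof -
  have le: "degree (shift_poly q - q) \<le> degree q"
    by (rule degree_diff_le) simp_all
  moreover have "coeff (shift_poly q - q) (degree q) = 0"
    by (simp add: lead_coeff_shift_poly)
  ultimately show ?thesis
    using assms by (metis leading_coeff_0_iff le_neq_implies_less)
qed

text \<open>Shifting keeps the leading coefficient, so the equation forces that coefficient to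
  vanish.\<close>

lemma twisted_shift_eq_0:
  assumes "smult c (shift_poly p) = smult d p" "c \<noteq> d"
  shows "p = 0"
proof -
  have "c * lead_coeff p = d * lead_coeff p"
    using arg_cong[OF assms(1), of "\<lambda>r. coeff r (degree p)"] by (simp add: lead_coeff_shift_poly)
  with assms(2) show ?thesis by simp
qed

lemma pcompose_power: "pcompose (p ^ n) q = pcompose p q ^ n"
  by (induction n) (simp_all add: pcompose_1 pcompose_mult)

text \<open>Induction on the degree: a suitable multiple of \<open>x ^ (d + 1)\<close> has a
  difference with the same leading term as \<open>p\<close>, and what remains of \<open>p\<close>
  has lower degree.\<close>

lemma antidifference:
  fixes p :: "complex poly"
  shows "\<exists>q. shift_poly q - q = p"
\<comment> \<open>The measure places 0 strictly below the nonzero constants, which have the same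
  degree.\<close>
proof (induction p rule: measure_induct_rule[of "\<lambda>p. if p = 0 then 0 else Suc (degree p)"])
  case (less p)
  show ?case
  proof (cases "p = 0")
    case True
    then show ?thesis by (intro exI[of _ 0]) simp
  next
    case False
    let ?d = "degree p"
    \<comment> \<open>The difference of \<open>x ^ (d + 1)\<close> has leading term
      \<open>(d + 1) * x ^ d\<close>, hence the divisor.\<close>
    define q0 where "q0 = monom (lead_coeff p / of_nat (Suc ?d)) (Suc ?d)"
    have c0: "lead_coeff p / of_nat (Suc ?d) \<noteq> 0"
      using False by (simp del: of_nat_Suc)
    have sq0: "shift_poly q0 = smult (lead_coeff p / of_nat (Suc ?d)) ([:1, 1:] ^ Suc ?d)"
      by (simp add: q0_def monom_altdef pcompose_smult pcompose_power pcompose_pCons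
          del: power_Suc of_nat_Suc)
    have co: "coeff (shift_poly q0 - q0) ?d = lead_coeff p"
      unfolding coeff_diff sq0
      by (simp add: coeff_linear_poly_power q0_def del: power_Suc of_nat_Suc)
    have dq0: "degree q0 = Suc ?d" using c0 by (simp add: q0_def degree_monom_eq del: of_nat_Suc)
    have le: "degree (shift_poly q0 - q0) \<le> ?d"
    proof (cases "shift_poly q0 - q0 = 0")
      case True
      then show ?thesis by (simp only: degree_0 zero_le)
    next
      case False
      then show ?thesis using shift_poly_diff_degree[of q0] dq0 by simp
    qed
    define r where "r = p - (shift_poly q0 - q0)"
    have "degree r \<le> ?d" unfolding r_def using le by (rule degree_diff_le[OF order_refl])
    moreover have "coeff r ?d = 0" using co by (simp add: r_def)
    ultimately have "r = 0 \<or> degree r < ?d"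
      by (metis leading_coeff_0_iff le_neq_implies_less)
    then have "\<exists>q. shift_poly q - q = r"
      by (intro less) (use False in auto)
    then obtain q1 where "shift_poly q1 - q1 = r" ..
    then have "shift_poly (q0 + q1) - (q0 + q1) = p"
      by (simp add: r_def pcompose_add algebra_simps)
    then show ?thesis ..
  qed
qed

text \<open>In the resonant case \<open>c = z\<close> the operator is a multiple of the plain
  difference. Otherwise it multiplies the leading coefficient by \<open>c - z \<noteq> 0\<close>, so
  dividing by \<open>c - z\<close> solves the equation up to a remainder of lower degree.\<close>

lemma twisted_antidifference:
  fixes p :: "complex poly"
  assumes "c \<noteq> 0"
  shows "\<exists>q. smult c (shift_poly q) - smult z q = p"
proof (cases "c = z")
  case True
  obtain q where "shift_poly q - q = smult (1/c) p" using antidifference by blast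
  then have "smult c (shift_poly q - q) = p" using assms by simp
  then show ?thesis using True by (auto simp: smult_diff_right)
next
  case False
  show ?thesis
  proof (induction p rule: measure_induct_rule[of "\<lambda>p. if p = 0 then 0 else Suc (degree p)"])
    case (less p)
    show ?case
    proof (cases "p = 0")
      case True
      then show ?thesis by (intro exI[of _ 0]) simp
    next
      case p: False
      \<comment> \<open>This is what is left of \<open>p\<close> after the operator has been applied
        to \<open>p / (c - z)\<close>.\<close>
      define r where "r = smult (- c / (c - z)) (shift_poly p - p)"
      have "r = 0 \<or> degree r < degree p"
        using shift_poly_diff_degree[of p] by (auto simp: r_def)
      then have "\<exists>q. smult c (shift_poly q) - smult z q = r"
        by (intro less) (use p in auto)
      then obtain q1 where q1: "smult c (shift_poly q1) - smult z q1 = r" ..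
      define q0 where "q0 = smult (1 / (c - z)) p"
      have "c * (1 / (c - z) * u) - z * (1 / (c - z) * v) = v - (- c / (c - z)) * (u - v)" for u v
        using False by (simp add: divide_simps) (simp add: algebra_simps)
      then have "smult c (shift_poly q0) - smult z q0 = p - r"
        unfolding q0_def r_def pcompose_smult by (intro poly_eqI) (simp only: coeff_smult coeff_diff)
      with q1 have "smult c (shift_poly (q0 + q1)) - smult z (q0 + q1) = p"
        by (simp add: pcompose_add smult_add_right algebra_simps)
      then show ?thesis ..
    qed
  qed
qed

text \<open>Outer induction on the set of bases, inner induction on the degree of the polynomial at
  the new base \<open>m\<close>. Subtracting \<open>m\<close> times the relation at \<open>n\<close>
  from the relation at \<open>n + 1\<close> lowers that degree, while at the other bases it acts
  injectively on polynomials.\<close>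

lemma exp_poly_independent:
  fixes p :: "complex \<Rightarrow> complex poly"
  assumes "finite S" "0 \<notin> S"
    and "\<And>n::nat. (\<Sum>l\<in>S. l ^ n * poly (p l) (of_nat n)) = 0"
  shows "\<forall>l\<in>S. p l = 0"
  using assms
proof (induction S arbitrary: p rule: finite_induct)
  case empty
  then show ?case by simp
next
  case (insert m S)
  have "\<forall>l\<in>insert m S. p l = 0" 
    if "\<And>n::nat. (\<Sum>l\<in>insert m S. l ^ n * poly (p l) (of_nat n)) = 0" for p :: "complex \<Rightarrow> complex poly"
    using that
  proof (induction p rule: measure_induct_rule[of "\<lambda>p. if p m = 0 then 0 else Suc (degree (p m))"])
    case (less p)
    show ?case
    proof (cases "p m = 0")
      case True
      then have "(\<Sum>l\<in>S. l ^ n * poly (p l) (of_nat n)) = 0" for n :: nat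
        using less.prems[of n] insert.hyps by simp
      then have "\<forall>l\<in>S. p l = 0" using insert.IH[of p] insert.prems by auto
      then show ?thesis using True by simp
    next
      case False
      \<comment> \<open>The coefficients of the relation at \<open>n + 1\<close> minus
        \<open>m\<close> times the relation at \<open>n\<close>.\<close>
      define p' where "p' = (\<lambda>l. smult l (shift_poly (p l)) - smult m (p l))"
      have sum: "(\<Sum>l\<in>insert m S. l ^ n * poly (p' l) (of_nat n)) = 0" for n :: nat
      proof -
        have "(\<Sum>l\<in>insert m S. l ^ n * poly (p' l) (of_nat n)) =
          (\<Sum>l\<in>insert m S. l ^ Suc n * poly (p l) (of_nat (Suc n))) -
          m * (\<Sum>l\<in>insert m S. l ^ n * poly (p l) (of_nat n))"
          by (simp only: sum_distrib_left sum_subtractf[symmetric])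
            (simp add: p'_def poly_pcompose algebra_simps)
        then show ?thesis by (simp only: less.prems mult_zero_right diff_0_right)
      qed
      have "p' m = smult m (shift_poly (p m) - p m)" by (simp add: p'_def smult_diff_right)
      then have "p' m = 0 \<or> degree (p' m) < degree (p m)"
        using shift_poly_diff_degree[of "p m"] by auto
      then have "\<forall>l\<in>insert m S. p' l = 0"
        by (intro less.IH[OF _ sum]) (use False in auto)
      then have S0: "\<forall>l\<in>S. p l = 0"
      proof (intro ballI)
        fix l assume "l \<in> S"
        with \<open>\<forall>l\<in>insert m S. p' l = 0\<close> have "smult l (shift_poly (p l)) = smult m (p l)"
          by (simp add: p'_def)
        moreover have "l \<noteq> m" using \<open>l \<in> S\<close> insert.hyps by blast
        ultimately show "p l = 0" by (rule twisted_shift_eq_0)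
      qed
      \<comment> \<open>Only the base \<open>m \<noteq> 0\<close> is left, so \<open>p m\<close> has
        every natural number as a root.\<close>
      have "poly (p m) (of_nat n) = 0" for n :: nat
      proof -
        have "(\<Sum>l\<in>S. l ^ n * poly (p l) (of_nat n)) = 0"
          using S0 by (intro sum.neutral) auto
        then have "m ^ n * poly (p m) (of_nat n) = 0"
          using less.prems[of n] insert.hyps by simp
        then show ?thesis using insert.prems(1) by simp
      qed
      then have "range of_nat \<subseteq> {x. poly (p m) x = 0}" by auto
      moreover have "infinite (range (of_nat :: nat \<Rightarrow> complex))"
        by (simp add: finite_image_iff inj_on_def)
      ultimately have "p m = 0"
        using poly_roots_finite[of "p m"] finite_subset by blast
      then show ?thesis using S0 by simp
    qed
  qed
  then show ?case using insert.prems(2) by blast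
qed

section \<open>Exponential polynomials of a real variable\<close>

inductive exp_poly :: "(real \<Rightarrow> complex) \<Rightarrow> bool" where
  single: "l \<noteq> 0 \<Longrightarrow> exp_poly (\<lambda>t. exp (of_real t * Ln l) * poly p (of_real t))"
| add: "exp_poly f \<Longrightarrow> exp_poly g \<Longrightarrow> exp_poly (\<lambda>t. f t + g t)"

lemma exp_poly_0: "exp_poly (\<lambda>t. 0)"
  using exp_poly.single[of 1 0] by simp

lemma exp_poly_mult: "exp_poly f \<Longrightarrow> exp_poly (\<lambda>t. c * f t)"
proof (induction rule: exp_poly.induct)
  case (single l p)
  then show ?case using exp_poly.single[of l "smult c p"] by (simp add: mult_ac)
qed (auto simp: distrib_left intro: exp_poly.add)

lemma exp_poly_sum: "(\<And>i. i \<in> I \<Longrightarrow> exp_poly (f i)) \<Longrightarrow> exp_poly (\<lambda>t. \<Sum>i\<in>I. f i t)"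
  by (induction I rule: infinite_finite_induct) (auto intro: exp_poly_0 exp_poly.add)

lemma exp_poly_shift: "exp_poly f \<Longrightarrow> exp_poly (\<lambda>t. f (t + s))"
proof (induction rule: exp_poly.induct)
  case (single l p)
  have "exp_poly (\<lambda>t. exp (of_real t * Ln l) *
      poly (smult (exp (of_real s * Ln l)) (pcompose p [:of_real s, 1:])) (of_real t))"
    using single by (rule exp_poly.single)
  then show ?case by (simp add: poly_pcompose exp_add ring_distribs mult_ac add_ac)
qed (auto intro: exp_poly.add)

text \<open>The principal branch is compatible with the reflection \<open>l \<mapsto> 1 / cnj l\<close>, including on the
  negative real axis, because this reflection preserves arguments.\<close>

lemma Ln_inverse_cnj: "l \<noteq> 0 \<Longrightarrow> Ln (inverse (cnj l)) = - cnj (Ln l)"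
  by (rule Ln_unique) (auto simp: exp_minus mpi_less_Im_Ln Im_Ln_le_pi simp flip: exp_cnj)

text \<open>This brings the conjugated entries of a matrix power with exponent \<open>- t\<close>
  into the class, as needed for the adjoint with respect to the Lorentz form.\<close>

lemma exp_poly_reflect: "exp_poly f \<Longrightarrow> exp_poly (\<lambda>t. cnj (f (- t)))"
proof (induction rule: exp_poly.induct)
  case (single l p)
  have "exp_poly (\<lambda>t. exp (of_real t * Ln (inverse (cnj l))) *
      poly (map_poly cnj (pcompose p [:0, -1:])) (of_real t))"
    using single by (intro exp_poly.single) simp
  moreover have "poly (map_poly cnj (pcompose p [:0, -1:])) (of_real t) = cnj (poly p (- of_real t))" for t
    using complex_cnj_complex_of_real[of t]
    by (metis (no_types) poly_cnj poly_pcompose poly_pCons poly_0 add_0 mult_zero_right mult_minus1_right add.right_neutral)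
  ultimately show ?case using single
    by (simp add: Ln_inverse_cnj exp_cnj)
qed (auto intro: exp_poly.add)

lemma continuous_exp_poly: "exp_poly f \<Longrightarrow> continuous_on S f"
  by (induction rule: exp_poly.induct) (auto intro!: continuous_intros)

text \<open>Terms with equal bases are collected, so that independence over distinct bases
  applies.\<close>

lemma exp_poly_normal_form:
  assumes "exp_poly f"
  shows "\<exists>S p. finite S \<and> 0 \<notin> S \<and>
    (\<forall>t. f t = (\<Sum>l\<in>S. exp (of_real t * Ln l) * poly (p l) (of_real t)))"
  using assms
proof (induction rule: exp_poly.induct)
    case (single l p)
    then show ?case by (intro exI[of _ "{l}"] exI[of _ "\<lambda>_. p"]) simp
  next
    case (add f g)
    then obtain S p T q where S: "finite S" "0 \<notin> S" "\<And>t. f t = (\<Sum>l\<in>S. exp (of_real t * Ln l) * poly (p l) (of_real t))"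
      and T: "finite T" "0 \<notin> T" "\<And>t. g t = (\<Sum>l\<in>T. exp (of_real t * Ln l) * poly (q l) (of_real t))"
      by blast
    define r where "r l = (if l \<in> S then p l else 0) + (if l \<in> T then q l else 0)" for l
    have 1: "(\<Sum>l\<in>S. h l * poly (p l) x) = (\<Sum>l\<in>S \<union> T. h l * poly (if l \<in> S then p l else 0) x)"
      for h :: "complex \<Rightarrow> complex" and x
      using S T by (intro sum.mono_neutral_cong_left) auto
    have 2: "(\<Sum>l\<in>T. h l * poly (q l) x) = (\<Sum>l\<in>S \<union> T. h l * poly (if l \<in> T then q l else 0) x)"
      for h :: "complex \<Rightarrow> complex" and x
      using S T by (intro sum.mono_neutral_cong_left) auto
    have "f t + g t = (\<Sum>l\<in>S \<union> T. exp (of_real t * Ln l) * poly (r l) (of_real t))" for t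
      unfolding S(3) T(3) 1 2 by (simp only: sum.distrib[symmetric] r_def poly_add distrib_left)
    then show ?case using S T by (intro exI[of _ "S \<union> T"] exI[of _ r]) auto
qed

text \<open>At natural numbers the principal values are ordinary powers \<open>l ^ n\<close>, so
  independence kills all coefficients. Allowing only the principal logarithm is essential: it
  excludes functions such as \<open>exp (2 * pi * \<i> * t) - 1\<close>, which vanish at every
  natural number.\<close>

lemma exp_poly_eq_0:
  assumes "exp_poly f" "\<And>n::nat. f (real n) = 0"
  shows "f t = 0"
proof -
  obtain S p where S: "finite S" "0 \<notin> S"
    "\<And>t. f t = (\<Sum>l\<in>S. exp (of_real t * Ln l) * poly (p l) (of_real t))"
    using exp_poly_normal_form[OF assms(1)] by blast
  have "(\<Sum>l\<in>S. l ^ n * poly (p l) (of_nat n)) = 0" for n :: nat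
  proof -
    have "f (real n) = (\<Sum>l\<in>S. l ^ n * poly (p l) (of_nat n))"
      unfolding S(3)
    proof (rule sum.cong)
      fix l assume "l \<in> S"
      then have "l \<noteq> 0" using S(2) by blast
      then show "exp (of_real (real n) * Ln l) * poly (p l) (of_real (real n)) = l ^ n * poly (p l) (of_nat n)"
        by (simp add: exp_of_nat_mult)
    qed simp
    then show ?thesis using assms(2) by simp
  qed
  then have "\<forall>l\<in>S. p l = 0" using exp_poly_independent[OF S(1,2)] by blast
  then show ?thesis unfolding S(3) by simp
qed

lemma exp_poly_eqI:
  assumes "exp_poly f" "exp_poly g" "\<And>n::nat. f (real n) = g (real n)"
  shows "f t = g t"
  using exp_poly_eq_0[OF exp_poly.add[OF assms(1) exp_poly_mult[OF assms(2), of "-1"]], of t] assms(3)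
  by simp

section \<open>Interpolation of linear recurrent sequences\<close>

lemma exp_poly_solve_recurrence:
  assumes "exp_poly f"
  shows "\<exists>g. exp_poly g \<and> (\<forall>t. g (t + 1) - z * g t = f t)"
  using assms
proof (induction rule: exp_poly.induct)
  case (single l p)
  obtain q where q: "smult l (shift_poly q) - smult z q = p"
    using twisted_antidifference[OF single, of z p] by blast
  have "exp (of_real (t + 1) * Ln l) * poly q (of_real (t + 1)) - z * (exp (of_real t * Ln l) * poly q (of_real t))
     = exp (of_real t * Ln l) * poly p (of_real t)" for t :: real
  proof -
    have "exp (of_real (t + 1) * Ln l) = l * exp (of_real t * Ln l)"
      using single by (simp add: exp_add ring_distribs)
    moreover have "poly p (of_real t) = l * poly q (of_real (t + 1)) - z * poly q (of_real t)"
      using arg_cong[OF q, of "\<lambda>r. poly r (of_real t)"] by (simp add: poly_pcompose add.commute)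
    ultimately show ?thesis by (simp only: right_diff_distrib mult_ac)
  qed
  then show ?case using exp_poly.single[OF single, of q] by blast
next
  case (add f g)
  then obtain f' g' where "exp_poly f'" "\<forall>t. f' (t + 1) - z * f' t = f t"
    "exp_poly g'" "\<forall>t. g' (t + 1) - z * g' t = g t" by blast
  then show ?case
    by (intro exI[of _ "\<lambda>t. f' t + g' t"]) (auto intro: exp_poly.add simp: algebra_simps)
qed

text \<open>Induction on the order of the recurrence. If \<open>z\<close> is a root of
  \<open>p\<close>, then \<open>a (n + 1) - z * a n\<close> satisfies the recurrence of the quotient
  \<open>p / (x - z)\<close>; its interpolation is known by induction and a first-order equation
  leads back to \<open>a\<close>. The nonzero constant term of \<open>p\<close> makes all roots
  nonzero, so that they are admissible bases.\<close>

lemma exp_poly_interpolation: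
  fixes a :: "nat \<Rightarrow> complex"
  assumes "p \<noteq> 0" "poly p 0 \<noteq> 0" "\<And>n. (\<Sum>i\<le>degree p. coeff p i * a (n + i)) = 0"
  shows "\<exists>f. exp_poly f \<and> (\<forall>n. f (real n) = a n)"
  using assms
proof (induction "degree p" arbitrary: p a)
  case 0
  then have "a n = 0" for n using "0.prems"(2) "0.prems"(3)[of n] "0.hyps" by (simp add: poly_0_coeff_0)
  then show ?case using exp_poly_0 by (intro exI[of _ "\<lambda>_. 0"]) simp
next
  case (Suc d)
  have "\<not> constant (poly p)" using Suc.hyps(2) by (simp add: constant_degree)
  then obtain z where "poly p z = 0" using Fundamental_Theorem_Algebra.fundamental_theorem_of_algebra by blast
  then obtain q where pq: "p = [:- z, 1:] * q" by (metis dvdE poly_eq_0_iff_dvd)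
  have z: "z \<noteq> 0" "poly q 0 \<noteq> 0" using Suc.prems(2) pq by auto
  have q0: "q \<noteq> 0" using Suc.prems pq by auto
  have dq: "d = degree q" using Suc.hyps(2) q0 unfolding pq
    by (subst (asm) degree_mult_eq) auto
  define b where "b n = a (Suc n) - z * a n" for n
  have "(\<Sum>i\<le>degree q. coeff q i * b (n + i)) = 0" for n
  proof -
    \<comment> \<open>Here \<open>p = x * q - z * q\<close>; the factor \<open>x\<close> shifts the
      index of \<open>a\<close> by one, and the top coefficient of the second sum vanishes.\<close>
    have "(\<Sum>i\<le>Suc d. coeff p i * a (n + i)) =
        (\<Sum>i\<le>Suc d. coeff (pCons 0 q) i * a (n + i)) - (\<Sum>i\<le>Suc d. z * coeff q i * a (n + i))"
      unfolding sum_subtractf[symmetric] by (rule sum.cong) (simp_all add: pq algebra_simps)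
    also have "(\<Sum>i\<le>Suc d. coeff (pCons 0 q) i * a (n + i)) = (\<Sum>i\<le>d. coeff q i * a (Suc (n + i)))"
      by (subst sum.atMost_Suc_shift) simp
    also have "(\<Sum>i\<le>Suc d. z * coeff q i * a (n + i)) = (\<Sum>i\<le>d. z * coeff q i * a (n + i))"
      using dq by (simp add: coeff_eq_0)
    also have "(\<Sum>i\<le>d. coeff q i * a (Suc (n + i))) - (\<Sum>i\<le>d. z * coeff q i * a (n + i)) =
        (\<Sum>i\<le>degree q. coeff q i * b (n + i))"
      unfolding sum_subtractf[symmetric] by (simp add: b_def dq algebra_simps)
    finally show ?thesis using Suc.prems(3)[of n] Suc.hyps(2) by simp
  qed
  then obtain g where g: "exp_poly g" "\<And>n. g (real n) = b n"
    using Suc.hyps(1)[OF dq q0 z(2)] by blast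
  obtain h where h: "exp_poly h" "\<And>t. h (t + 1) - z * h t = g t"
    using exp_poly_solve_recurrence[OF g(1)] by blast
  \<comment> \<open>A multiple of the homogeneous solution \<open>z ^ t\<close> corrects the initial
    value; the first-order recurrence then fixes all other values.\<close>
  define c where "c = a 0 - h 0"
  have "exp_poly (\<lambda>t. h t + exp (of_real t * Ln z) * poly [:c:] (of_real t))"
    using z h by (intro exp_poly.add exp_poly.single)
  moreover have "h (real n) + exp (of_real (real n) * Ln z) * poly [:c:] (of_real (real n)) = a n" for n
  proof (induction n)
    case 0
    then show ?case by (simp add: c_def)
  next
    case (Suc n)
    have "exp (of_real (real (Suc n)) * Ln z) = z * exp (of_real (real n) * Ln z)"
      using z by (simp add: exp_add ring_distribs)
    moreover have "h (real (Suc n)) = z * h (real n) + a (Suc n) - z * a n"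
      using h(2)[of "real n"] g(2)[of n] by (simp add: b_def algebra_simps)
    ultimately have "h (real (Suc n)) + exp (of_real (real (Suc n)) * Ln z) * poly [:c:] (of_real (real (Suc n)))
      = a (Suc n) + z * (h (real n) + exp (of_real (real n) * Ln z) * poly [:c:] (of_real (real n)) - a n)"
      by (simp only: poly_pCons poly_0 mult_zero_right add_0_right) (simp only: ring_distribs mult_ac add_ac diff_conv_add_uminus mult_minus_right)
    then show ?case using Suc by simp
  qed
  ultimately show ?case by blast
qed

section \<open>Real powers of matrices\<close>

primrec mpow :: "complex ^ 'k ^ 'k \<Rightarrow> nat \<Rightarrow> complex ^ 'k ^ 'k" where
  "mpow M 0 = mat 1"
| "mpow M (Suc n) = M ** mpow M n"

lemma mpow_add: "mpow M (m + n) = mpow M m ** mpow M n"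
  by (induction m) (simp_all add: matrix_mul_assoc)

lemma mpow_inverse:
  assumes "N ** M = mat 1"
  shows "mpow N n ** mpow M n = mat 1"
proof (induction n)
  case (Suc n)
  have comm: "mpow N (Suc n) = mpow N n ** N"
    using mpow_add[of N n 1] by simp
  have "mpow N (Suc n) ** mpow M (Suc n) = mpow N n ** (N ** M) ** mpow M n"
    unfolding comm by (simp add: matrix_mul_assoc)
  then show ?case using Suc assms by simp
qed simp

text \<open>Distinct terms form a linearly dependent set because there are more of them than the
  dimension. A repeated term gives the relation \<open>x i - x j = 0\<close> instead.\<close>

lemma family_dependence:
  fixes x :: "nat \<Rightarrow> 'a::euclidean_space"
  shows "\<exists>c D. (\<exists>i\<le>D. c i \<noteq> 0) \<and> (\<Sum>i\<le>D. c i *\<^sub>R x i) = 0"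
proof (cases "inj_on x {..DIM('a)}")
  case True
  have "card (x ` {..DIM('a)}) = Suc DIM('a)" using True by (simp add: card_image)
  then have "dependent (x ` {..DIM('a)})"
    using independent_bound[of "x ` {..DIM('a)}"] by linarith
  then obtain u v where u: "v \<in> x ` {..DIM('a)}" "u v \<noteq> 0" "(\<Sum>v\<in>x ` {..DIM('a)}. u v *\<^sub>R v) = 0"
    by (subst (asm) real_vector.dependent_finite) auto
  then show ?thesis using sum.reindex[OF True, of "\<lambda>v. u v *\<^sub>R v"]
    by (intro exI[of _ "u \<circ> x"] exI[of _ "DIM('a)"]) auto
next
  case False
  then obtain i j where ij: "i \<le> DIM('a)" "j \<le> DIM('a)" "i \<noteq> j" "x i = x j"
    by (auto simp: inj_on_def)
  define c :: "nat \<Rightarrow> real" where "c k = (if k = i then 1 else 0) - (if k = j then 1 else 0)" for k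
  have "(\<Sum>k\<le>DIM('a). c k *\<^sub>R x k) =
    (\<Sum>k\<le>DIM('a). if k = i then x k else 0) - (\<Sum>k\<le>DIM('a). if k = j then x k else 0)"
    unfolding sum_subtractf[symmetric] by (rule sum.cong) (auto simp: c_def)
  also have "\<dots> = 0" using ij by simp
  finally show ?thesis using ij
    by (intro exI[of _ c] exI[of _ "DIM('a)"]) (auto simp: c_def intro!: exI[of _ i])
qed

lemma matrix_mult_sum_scaleR:
  fixes A :: "complex ^ 'k ^ 'k"
  shows "A ** (\<Sum>i\<in>I. c i *\<^sub>R B i) = (\<Sum>i\<in>I. c i *\<^sub>R (A ** B i))"
  by (induction I rule: infinite_finite_induct)
    (simp_all add: matrix_add_ldistrib, simp_all add: vec_eq_iff matrix_matrix_mult_def scaleR_sum_right)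

text \<open>A linear relation between powers of \<open>M\<close> exists for reasons of dimension.
  Since \<open>M\<close> is invertible, its lowest power can be cancelled, which makes the constant
  term nonzero; multiplying by \<open>M ^ n\<close> turns the relation into a recurrence for every
  entry.\<close>

lemma annihilating_polynomial:
  fixes M :: "complex ^ 'k ^ 'k"
  assumes "N ** M = mat 1"
  shows "\<exists>p. poly p 0 \<noteq> 0 \<and> (\<forall>a b n. (\<Sum>i\<le>degree p. coeff p i * mpow M (n + i) $ a $ b) = 0)"
proof -
  obtain c D where c: "\<exists>i\<le>D. c i \<noteq> 0" "(\<Sum>i\<le>D. c i *\<^sub>R mpow M i) = 0"
    using family_dependence[of "mpow M"] by blast
  \<comment> \<open>The lowest power that occurs in the relation; it becomes the constant
    term.\<close>
  define j where "j = (LEAST i. c i \<noteq> 0)"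
  obtain i where i: "i \<le> D" "c i \<noteq> 0" using c(1) by blast
  have j: "c j \<noteq> 0" "\<And>i. i < j \<Longrightarrow> c i = 0" "j \<le> D"
    unfolding j_def
    by (rule LeastI[of "\<lambda>i. c i \<noteq> 0", OF i(2)], use not_less_Least in blast,
        rule order_trans[OF Least_le[of "\<lambda>i. c i \<noteq> 0", OF i(2)] i(1)])
  have "0 = (\<Sum>i\<in>{j..D}. c i *\<^sub>R mpow M i)"
    unfolding c(2)[symmetric] using j by (intro sum.mono_neutral_right) auto
  also have "\<dots> = (\<Sum>i\<le>D - j. c (i + j) *\<^sub>R mpow M (i + j))"
    using j(3) by (intro sum.reindex_bij_witness[of _ "\<lambda>i. i + j" "\<lambda>i. i - j"]) auto
  finally have s: "(\<Sum>i\<le>D - j. c (i + j) *\<^sub>R mpow M (i + j)) = 0" ..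
  have shift: "(\<Sum>i\<le>D - j. c (i + j) *\<^sub>R mpow M (n + i)) = 0" for n
  proof -
    \<comment> \<open>The factor \<open>mpow N j\<close> cancels \<open>M ^ j\<close>, and
      \<open>mpow M n\<close> moves the relation up to start at \<open>n\<close>.\<close>
    have e: "mpow M n ** mpow N j ** mpow M (i + j) = mpow M (n + i)" for i
    proof -
      have "mpow M n ** mpow N j ** mpow M (j + i) = mpow M n ** (mpow N j ** mpow M j) ** mpow M i"
        unfolding mpow_add by (simp only: matrix_mul_assoc)
      then show ?thesis using mpow_inverse[OF assms, of j] by (simp add: mpow_add add.commute[of i])
    qed
    have "(mpow M n ** mpow N j) ** (\<Sum>i\<le>D - j. c (i + j) *\<^sub>R mpow M (i + j)) = 0"
      unfolding s by simp
    then show ?thesis unfolding matrix_mult_sum_scaleR e .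
  qed
  define p where "p = (\<Sum>i\<le>D - j. monom (complex_of_real (c (i + j))) i)"
  have cp: "coeff p i = (if i \<le> D - j then of_real (c (i + j)) else 0)" for i
    by (simp add: p_def coeff_sum)
  have "(\<Sum>i\<le>degree p. coeff p i * mpow M (n + i) $ a $ b) = 0" for a b n
  proof -
    have "(\<Sum>i\<le>degree p. coeff p i * mpow M (n + i) $ a $ b) = (\<Sum>i\<le>D - j. coeff p i * mpow M (n + i) $ a $ b)"
    proof (rule sum.mono_neutral_left)
      show "{..degree p} \<subseteq> {..D - j}"
        using cp by (auto intro!: degree_le elim: order_trans)
      show "\<forall>i\<in>{..D - j} - {..degree p}. coeff p i * mpow M (n + i) $ a $ b = 0"
        by (auto simp: coeff_eq_0)
    qed simp
    also have "\<dots> = (\<Sum>i\<le>D - j. c (i + j) *\<^sub>R mpow M (n + i)) $ a $ b"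
      by (simp add: cp) (simp add: scaleR_conv_of_real)
    finally show ?thesis unfolding shift by simp
  qed
  moreover have "poly p 0 \<noteq> 0" using j by (simp add: poly_0_coeff_0 cp)
  ultimately show ?thesis by blast
qed

lemma exp_poly_mult_right: "exp_poly f \<Longrightarrow> exp_poly (\<lambda>t. f t * c)"
  using exp_poly_mult[of f c] by (simp add: mult.commute)

lemma exp_poly_diff: "exp_poly f \<Longrightarrow> exp_poly g \<Longrightarrow> exp_poly (\<lambda>t. f t - g t)"
  using exp_poly.add[of f "\<lambda>t. (-1) * g t"] exp_poly_mult[of g "-1"] by simp

text \<open>The entries are interpolated one by one. The law of exponents passes from natural to
  real numbers in two rounds, one exponent at a time.\<close>

lemma real_matrix_powers:
  fixes M :: "complex ^ 'k ^ 'k"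
  assumes "N ** M = mat 1"
  shows "\<exists>R :: real \<Rightarrow> complex ^ 'k ^ 'k. (\<forall>a b. exp_poly (\<lambda>t. R t $ a $ b)) \<and>
    (\<forall>n. R (real n) = mpow M n) \<and> (\<forall>s t. R (s + t) = R s ** R t)"
proof -
  obtain p where p: "poly p 0 \<noteq> 0" "\<And>a b n. (\<Sum>i\<le>degree p. coeff p i * mpow M (n + i) $ a $ b) = 0"
    using annihilating_polynomial[OF assms] by blast
  have "\<exists>f. exp_poly f \<and> (\<forall>n. f (real n) = mpow M n $ a $ b)" for a b
    using p by (intro exp_poly_interpolation[of p]) auto
  then obtain F where F: "\<And>a b. exp_poly (F a b)" "\<And>a b n. F a b (real n) = mpow M n $ a $ b"
    by metis
  define R :: "real \<Rightarrow> complex ^ 'k ^ 'k" where "R t = (\<chi> a b. F a b t)" for t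
  have Rab: "exp_poly (\<lambda>t. R t $ a $ b)" for a b using F(1) by (simp add: R_def)
  have Rn: "R (real n) = mpow M n" for n by (simp add: R_def F(2) vec_eq_iff)
  \<comment> \<open>First round: one exponent stays natural and the other becomes real.\<close>
  have 1: "R (t + real n) = mpow M n ** R t" for n t
  proof -
    have "R (t + real n) $ a $ b = (mpow M n ** R t) $ a $ b" for a b
    proof (rule exp_poly_eqI[of "\<lambda>t. R (t + real n) $ a $ b" "\<lambda>t. (mpow M n ** R t) $ a $ b"])
      show "exp_poly (\<lambda>t. R (t + real n) $ a $ b)"
        by (rule exp_poly_shift[OF Rab])
      show "exp_poly (\<lambda>t. (mpow M n ** R t) $ a $ b)"
        by (auto simp: matrix_matrix_mult_def intro!: exp_poly_sum exp_poly_mult Rab)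
      show "R (real m + real n) $ a $ b = (mpow M n ** R (real m)) $ a $ b" for m
        using Rn[of "m + n"] mpow_add[of M n m] by (simp add: Rn add.commute)
    qed
    then show ?thesis by (simp add: vec_eq_iff)
  qed
  \<comment> \<open>Second round: \<open>t\<close> is real and fixed while \<open>s\<close> varies.
    Both sides are linear in the varying entries, so no products of exponential polynomials occur;
    such products could leave the principal branch.\<close>
  have "R (s + t) = R s ** R t" for s t
  proof -
    have "R (s + t) $ a $ b = (R s ** R t) $ a $ b" for a b
    proof (rule exp_poly_eqI[of "\<lambda>s. R (s + t) $ a $ b" "\<lambda>s. (R s ** R t) $ a $ b"])
      show "exp_poly (\<lambda>s. R (s + t) $ a $ b)"
        by (rule exp_poly_shift[OF Rab])
      show "exp_poly (\<lambda>s. (R s ** R t) $ a $ b)"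
        by (auto simp: matrix_matrix_mult_def intro!: exp_poly_sum exp_poly_mult_right Rab)
      show "R (real m + t) $ a $ b = (R (real m) ** R t) $ a $ b" for m
        using 1[of t m] by (simp add: Rn add.commute)
    qed
    then show ?thesis by (simp add: vec_eq_iff)
  qed
  then show ?thesis using Rab Rn by blast
qed

section \<open>Matrices preserving the Lorentz form, whose positive direction is the extra
  coordinate \<open>None\<close>\<close>

definition lorentz_form :: "complex ^ ('n::finite) option \<Rightarrow> complex ^ ('n::finite) option \<Rightarrow> complex" where
  "lorentz_form v w = v $ None * cnj (w $ None) - (\<Sum>i\<in>UNIV. v $ Some i * cnj (w $ Some i))"

definition preserves_form :: "complex ^ ('n::finite) option ^ 'n option \<Rightarrow> bool" where
  "preserves_form M \<longleftrightarrow> (\<forall>v w. lorentz_form (M *v v) (M *v w) = lorentz_form v w)"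

lemma preserves_form_mult: "preserves_form M \<Longrightarrow> preserves_form N \<Longrightarrow> preserves_form (M ** N)"
  by (simp add: preserves_form_def flip: matrix_vector_mul_assoc)

lemma preserves_form_mpow: "preserves_form M \<Longrightarrow> preserves_form (mpow M n)"
  by (induction n) (auto intro: preserves_form_mult simp: preserves_form_def[of "mat 1"])

text \<open>The powers with natural exponents preserve the form. This passes to real exponents in
  the shape of an adjoint identity, from which invariance follows by
  \<open>R (- t) ** R t = mat 1\<close>.\<close>

lemma one_parameter_group:
  fixes M :: "complex ^ ('n::finite) option ^ 'n option"
  assumes "N ** M = mat 1" "preserves_form M"
  shows "\<exists>R :: real \<Rightarrow> complex ^ 'n option ^ 'n option.
    (\<forall>a b. continuous_on UNIV (\<lambda>t. R t $ a $ b)) \<and> R 0 = mat 1 \<and> R 1 = M \<and>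
    (\<forall>s t. R (s + t) = R s ** R t) \<and> (\<forall>t. preserves_form (R t))"
proof -
  from real_matrix_powers[OF assms(1)] obtain R where
    "(\<forall>a b. exp_poly (\<lambda>t. R t $ a $ b)) \<and> (\<forall>n. R (real n) = mpow M n) \<and>
     (\<forall>s t. R (s + t) = R s ** R t)" ..
  then have R: "\<And>a b. exp_poly (\<lambda>t. R t $ a $ b)" "\<And>n. R (real n) = mpow M n"
    "\<And>s t. R (s + t) = R s ** R t"
    by simp_all
  have R0: "R 0 = mat 1" using R(2)[of 0] by simp
  \<comment> \<open>The invariance itself contains products of entries of \<open>R t\<close> with
    conjugates. Moving one factor across the form leaves entries of \<open>R t\<close> on the left
    and conjugated entries of \<open>R (- t)\<close> on the right, each side an exponential
    polynomial.\<close>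
  have adj: "lorentz_form (R t *v v) w = lorentz_form v (R (- t) *v w)" for t v w
  proof (rule exp_poly_eqI[of "\<lambda>t. lorentz_form (R t *v v) w" "\<lambda>t. lorentz_form v (R (- t) *v w)"])
    show "exp_poly (\<lambda>t. lorentz_form (R t *v v) w)"
      unfolding lorentz_form_def matrix_vector_mult_def
      by (auto intro!: exp_poly_diff exp_poly_sum exp_poly_mult_right R(1))
    show "exp_poly (\<lambda>t. lorentz_form v (R (- t) *v w))"
      unfolding lorentz_form_def matrix_vector_mult_def
      by (auto intro!: exp_poly_diff exp_poly_sum exp_poly_mult exp_poly_mult_right exp_poly_reflect R(1))
    fix n :: nat
    have "R (real n) ** R (- real n) = mat 1" using R(3)[of "real n" "- real n"] R0 by simp
    then have "w = R (real n) *v (R (- real n) *v w)" by (simp add: matrix_vector_mul_assoc)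
    then show "lorentz_form (R (real n) *v v) w = lorentz_form v (R (- real n) *v w)"
      using preserves_form_mpow[OF assms(2), of n] by (metis R(2) preserves_form_def)
  qed
  have "R (- t) ** R t = mat 1" for t
    using R(3)[of "- t" t, symmetric] R0 by simp
  then have "preserves_form (R t)" for t
    unfolding preserves_form_def adj matrix_vector_mul_assoc by simp
  moreover have "R 1 = M" using R(2)[of 1] by simp
  ultimately show ?thesis using R(1,3) R0 continuous_exp_poly
    by (intro exI[of _ R] conjI allI) auto
qed

section \<open>Projective action on the ball\<close>

lemma UNIV_option_sum: "(\<Sum>i\<in>UNIV. f i) = f None + (\<Sum>i\<in>UNIV. f (Some i))"
  for f :: "'n::finite option \<Rightarrow> 'a::comm_monoid_add"
  by (simp add: UNIV_option_conv sum.reindex)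

lemma norm_vec_power2: "(norm v)\<^sup>2 = (\<Sum>i\<in>UNIV. (norm (v $ i))\<^sup>2)" for v :: "'a::real_normed_vector ^ 'n"
  by (simp add: norm_vec_def L2_set_def sum_nonneg)

definition homogenize :: "complex ^ 'n \<Rightarrow> complex ^ ('n::finite) option" where
  "homogenize z = (\<chi> i. case i of None \<Rightarrow> 1 | Some j \<Rightarrow> z $ j)"

definition dehomogenize :: "complex ^ ('n::finite) option \<Rightarrow> complex ^ 'n" where
  "dehomogenize v = (\<chi> j. v $ Some j / v $ None)"

text \<open>The linear fractional map induced on complex lines, in the affine chart where the
  coordinate \<open>None\<close> equals 1. Its values are meaningful where the denominator is
  nonzero.\<close>

definition proj_act :: "complex ^ ('n::finite) option ^ 'n option \<Rightarrow> complex ^ 'n \<Rightarrow> complex ^ 'n" where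
  "proj_act M z = dehomogenize (M *v homogenize z)"

lemma homogenize_nth [simp]: "homogenize z $ None = 1" "homogenize z $ Some j = z $ j"
  by (simp_all add: homogenize_def)

lemma dehomogenize_nth [simp]: "dehomogenize v $ j = v $ Some j / v $ None"
  by (simp add: dehomogenize_def)

lemma dehomogenize_homogenize [simp]: "dehomogenize (homogenize z) = z"
  by (simp add: vec_eq_iff)

lemma dehomogenize_scale: "c \<noteq> 0 \<Longrightarrow> dehomogenize (c *s v) = dehomogenize v"
  by (simp add: vec_eq_iff)

lemma homogenize_dehomogenize:
  assumes "v $ None \<noteq> 0"
  shows "v $ None *s homogenize (dehomogenize v) = v"
proof -
  have "(v $ None *s homogenize (dehomogenize v)) $ i = v $ i" for i
    using assms by (cases i) simp_all
  then show ?thesis by (simp add: vec_eq_iff)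
qed

lemma lorentz_form_self:
  "lorentz_form v v = of_real ((cmod (v $ None))\<^sup>2 - (\<Sum>i\<in>UNIV. (cmod (v $ Some i))\<^sup>2))"
  by (simp add: lorentz_form_def complex_norm_square del: of_real_power)

lemma lorentz_form_homogenize: "lorentz_form (homogenize z) (homogenize z) = of_real (1 - (norm z)\<^sup>2)"
  by (simp add: lorentz_form_self norm_vec_power2)

lemma lorentz_form_scale: "lorentz_form (c *s v) (c *s v) = of_real ((cmod c)\<^sup>2) * lorentz_form v v"
  by (simp add: lorentz_form_self norm_mult power_mult_distrib right_diff_distrib sum_distrib_left)

text \<open>If the coordinate \<open>None\<close> is 0, the form is at most 0; otherwise rescaling
  that coordinate to 1 keeps the sign of the form. Points of the ball thus correspond to positive
  lines, which matrices preserving the form permute among themselves.\<close>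

lemma positive_vector:
  assumes "0 < Re (lorentz_form v v)"
  shows "v $ None \<noteq> 0" "dehomogenize v \<in> ball 0 1"
proof -
  show 0: "v $ None \<noteq> 0"
  proof
    assume "v $ None = 0"
    then show False using assms sum_nonneg[of UNIV "\<lambda>i. (cmod (v $ Some i))\<^sup>2"]
      by (simp add: lorentz_form_self)
  qed
  have "lorentz_form v v = of_real ((cmod (v $ None))\<^sup>2) * of_real (1 - (norm (dehomogenize v))\<^sup>2)"
    using lorentz_form_scale[of "v $ None" "homogenize (dehomogenize v)"]
    by (simp only: lorentz_form_homogenize homogenize_dehomogenize[OF 0])
  then have "0 < (cmod (v $ None))\<^sup>2 * (1 - (norm (dehomogenize v))\<^sup>2)"
    using assms by (simp flip: of_real_mult)
  then have "(norm (dehomogenize v))\<^sup>2 < 1" by (simp add: zero_less_mult_iff)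
  then show "dehomogenize v \<in> ball 0 1" by (simp add: power_less_one_iff abs_square_less_1)
qed

lemma homogenize_ball_positive: "z \<in> ball 0 1 \<Longrightarrow> 0 < Re (lorentz_form (homogenize z) (homogenize z))"
  by (simp add: lorentz_form_homogenize abs_square_less_1)

lemma proj_act_ball:
  assumes "preserves_form M" "z \<in> ball 0 1"
  shows "(M *v homogenize z) $ None \<noteq> 0" "proj_act M z \<in> ball 0 1"
  using positive_vector[of "M *v homogenize z"] homogenize_ball_positive[OF assms(2)] assms(1)
  by (simp_all add: preserves_form_def proj_act_def)

text \<open>The denominator of the inner map is a nonzero scalar, which the outer matrix carries
  along and the chart cancels.\<close>

lemma proj_act_mult:
  assumes "preserves_form N" "z \<in> ball 0 1"
  shows "proj_act (M ** N) z = proj_act M (proj_act N z)"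
proof -
  let ?v = "N *v homogenize z"
  have nz: "?v $ None \<noteq> 0" by (rule proj_act_ball(1)[OF assms])
  have "M *v ?v = ?v $ None *s (M *v homogenize (dehomogenize ?v))"
    using vector_scalar_commute[of M "?v $ None" "homogenize (dehomogenize ?v)"]
    unfolding homogenize_dehomogenize[OF nz] .
  then show ?thesis
    using dehomogenize_scale[OF nz] unfolding proj_act_def matrix_vector_mul_assoc[symmetric] by metis
qed

lemma proj_act_one [simp]: "proj_act (mat 1) z = z"
  by (simp add: proj_act_def)

section \<open>Holomorphy of projective maps\<close>

lemma has_derivative_vecI:
  fixes f :: "'a::real_normed_vector \<Rightarrow> 'b::euclidean_space ^ 'n"
  assumes "\<And>i. ((\<lambda>x. f x $ i) has_derivative (\<lambda>h. f' h $ i)) (at a within S)"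
  shows "(f has_derivative f') (at a within S)"
  unfolding has_derivative_componentwise_within[of f]
  by (auto simp: Basis_vec_def inner_axis intro!: has_derivative_inner_left assms)

lemma matrix_homogenize_nth:
  "(M *v homogenize z) $ i = M $ i $ None + (\<Sum>k\<in>UNIV. M $ i $ Some k * z $ k)"
  by (simp add: matrix_vector_mult_def UNIV_option_sum)

lemma proj_act_has_derivative:
  fixes M :: "complex ^ ('n::finite) option ^ 'n option"
  assumes "(M *v homogenize z) $ None \<noteq> 0"
  shows "\<exists>A. (proj_act M has_derivative (*v) A) (at z)"
proof
  let ?L = "\<lambda>i z. (M *v homogenize z) $ i"
  \<comment> \<open>The complex Jacobian, read off from the quotient rule in each component.\<close>
  define A :: "complex ^ 'n ^ 'n" where
    "A = (\<chi> j k. (M $ Some j $ Some k * ?L None z - ?L (Some j) z * M $ None $ Some k) / (?L None z * ?L None z))"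
  have L: "(?L i has_derivative (\<lambda>h. \<Sum>k\<in>UNIV. M $ i $ Some k * h $ k)) (at z)" for i
  proof -
    have "((\<lambda>z. M $ i $ None + (\<Sum>k\<in>UNIV. M $ i $ Some k * z $ k)) has_derivative
        (\<lambda>h. 0 + (\<Sum>k\<in>UNIV. M $ i $ Some k * h $ k))) (at z)"
      by (intro has_derivative_add has_derivative_const has_derivative_sum has_derivative_mult_right
          bounded_linear_imp_has_derivative bounded_linear_vec_nth)
    then show ?thesis by (simp add: matrix_homogenize_nth)
  qed
  show "(proj_act M has_derivative (*v) A) (at z)"
  proof (rule has_derivative_vecI)
    fix j
    have "((\<lambda>x. ?L (Some j) x / ?L None x) has_derivative
        (\<lambda>h. ((\<Sum>k\<in>UNIV. M $ Some j $ Some k * h $ k) * ?L None z -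
           ?L (Some j) z * (\<Sum>k\<in>UNIV. M $ None $ Some k * h $ k)) / (?L None z * ?L None z))) (at z)"
      by (rule has_derivative_divide'[OF L L assms])
    moreover have "((\<Sum>k\<in>UNIV. M $ Some j $ Some k * h $ k) * d -
           e * (\<Sum>k\<in>UNIV. M $ None $ Some k * h $ k)) / (d * d) =
        (\<Sum>k\<in>UNIV. (M $ Some j $ Some k * d - e * M $ None $ Some k) / (d * d) * h $ k)" for h d e
      by (simp add: sum_distrib_left sum_distrib_right sum_divide_distrib flip: sum_subtractf)
        (simp add: algebra_simps diff_divide_distrib)
    ultimately show "((\<lambda>x. proj_act M x $ j) has_derivative (\<lambda>h. (A *v h) $ j)) (at z)"
      by (simp add: proj_act_def A_def matrix_vector_mult_def)
  qed
qed

lemma holomorphic_map_on_proj_act: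
  assumes "preserves_form M"
  shows "holomorphic_map_on (proj_act M) (ball 0 1)"
  unfolding holomorphic_map_on_def
  using proj_act_has_derivative proj_act_ball(1)[OF assms] matrix_vector_mul_linear_gen by blast

lemma holomorphic_map_on_cong:
  assumes "holomorphic_map_on f D" "open D" "\<And>z. z \<in> D \<Longrightarrow> f z = g z"
  shows "holomorphic_map_on g D"
  using assms unfolding holomorphic_map_on_def
  by (meson has_derivative_transform_within_open)

lemma holomorphic_map_on_compose:
  assumes "holomorphic_map_on f D" "holomorphic_map_on g E" "f ` D \<subseteq> E"
  shows "holomorphic_map_on (g \<circ> f) D"
  unfolding holomorphic_map_on_def
proof
  fix z assume "z \<in> D"
  with assms obtain f' g' where "Vector_Spaces.linear (*s) (*s) f'" "(f has_derivative f') (at z)"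
    "Vector_Spaces.linear (*s) (*s) g'" "(g has_derivative g') (at (f z))"
    unfolding holomorphic_map_on_def by blast
  then show "\<exists>h. Vector_Spaces.linear (*s) (*s) h \<and> (g \<circ> f has_derivative h) (at z)"
    using diff_chain_at Vector_Spaces.linear_compose by blast
qed

lemma holomorphic_automorphismI:
  assumes "open D" "holomorphic_map_on f D" "holomorphic_map_on g D"
    and "\<And>z. z \<in> D \<Longrightarrow> f z \<in> D" "\<And>z. z \<in> D \<Longrightarrow> g z \<in> D"
    and "\<And>z. z \<in> D \<Longrightarrow> g (f z) = z" "\<And>z. z \<in> D \<Longrightarrow> f (g z) = z"
  shows "holomorphic_automorphism D f"
  unfolding holomorphic_automorphism_def
proof (intro conjI)
  show bij: "bij_betw f D D" using assms by (intro bij_betw_byWitness[of D g f D]) auto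
  have "g z = inv_into D f z" if "z \<in> D" for z
    using bij_betw_inv_into_left[OF bij, of "g z"] assms that by simp
  then show "holomorphic_map_on (inv_into D f) D"
    using holomorphic_map_on_cong assms by blast
qed (rule assms)

lemma holomorphic_automorphism_proj_act:
  assumes "preserves_form M" "preserves_form N" "M ** N = mat 1" "N ** M = mat 1"
  shows "holomorphic_automorphism (ball 0 1) (proj_act M)"
  using assms proj_act_ball(2) proj_act_mult[of M _ N] proj_act_mult[of N _ M]
  by (intro holomorphic_automorphismI[of _ _ "proj_act N"] holomorphic_map_on_proj_act) auto

section \<open>Joint continuity and the compact-open topology\<close>

lemma continuous_on_slice:
  assumes "continuous_on (T \<times> D) (\<lambda>(t, z). \<phi> t z)" "t \<in> T"
  shows "continuous_on D (\<phi> t)"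
  using continuous_on_compose2[OF assms(1) continuous_on_Pair[OF continuous_on_const[of D t] continuous_on_id[of D]]] assms(2)
  by auto

text \<open>The parameters for which some point of \<open>K\<close> leaves \<open>U\<close> form the
  projection of a closed set along the compact factor \<open>K\<close>, hence a closed set.\<close>

lemma continuous_map_compact_open:
  fixes \<phi> :: "real \<Rightarrow> 'a::euclidean_space \<Rightarrow> 'b::euclidean_space"
  assumes cont: "continuous_on (T \<times> D) (\<lambda>(t, z). \<phi> t z)"
    and maps: "\<And>t z. t \<in> T \<Longrightarrow> z \<in> D \<Longrightarrow> \<phi> t z \<in> E"
  shows "continuous_map (top_of_set T) (compact_open_topology D E) \<phi>"
  unfolding compact_open_topology_def
proof (rule continuous_on_generated_topo)
  fix W assume "W \<in> {{f. continuous_on D f \<and> f ` D \<subseteq> E \<and> f ` K \<subseteq> U} |K U. compact K \<and> K \<subseteq> D \<and> open U}"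
  then obtain K U where W: "W = {f. continuous_on D f \<and> f ` D \<subseteq> E \<and> f ` K \<subseteq> U}"
    and K: "compact K" "K \<subseteq> D" and U: "open U" by blast
  have "continuous_on (K \<times> T) (\<lambda>x. case (snd x, fst x) of (t, z) \<Rightarrow> \<phi> t z)"
    by (rule continuous_on_compose2[OF cont]) (use K(2) in \<open>auto intro!: continuous_intros\<close>)
  then have cont': "continuous_on (K \<times> T) (\<lambda>(z, t). \<phi> t z)"
    by (simp add: case_prod_unfold)
  let ?C = "{x \<in> K \<times> T. (case x of (z, t) \<Rightarrow> \<phi> t z) \<in> - U}"
  have "closedin (top_of_set (K \<times> T)) ?C"
    using continuous_closedin_preimage[OF cont', of "- U"] U
    by (simp add: closed_Compl vimage_def Int_def)
  then have "closedin (top_of_set T) {t. \<exists>z. z \<in> K \<and> (z, t) \<in> ?C}"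
    by (rule closedin_compact_projection[OF K(1)])
  then have "openin (top_of_set T) (T - {t. \<exists>z. z \<in> K \<and> (z, t) \<in> ?C})"
    by (simp add: closedin_def)
  moreover have "T - {t. \<exists>z. z \<in> K \<and> (z, t) \<in> ?C} = \<phi> -` W \<inter> topspace (top_of_set T)"
    using continuous_on_slice[OF cont] maps K(2) unfolding W by auto
  ultimately show "openin (top_of_set T) (\<phi> -` W \<inter> topspace (top_of_set T))" by simp
next
  let ?S = "{{f. continuous_on D f \<and> f ` D \<subseteq> E \<and> f ` K \<subseteq> U} |K U. compact K \<and> K \<subseteq> D \<and> open U}"
  \<comment> \<open>The subbasic set for empty \<open>K\<close> already contains every admissible
    map.\<close>
  have "{f. continuous_on D f \<and> f ` D \<subseteq> E \<and> f ` {} \<subseteq> UNIV} \<in> ?S"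
    by (rule CollectI, intro exI[of _ "{}"] exI[of _ UNIV]) simp
  then have "{f. continuous_on D f \<and> f ` D \<subseteq> E \<and> f ` {} \<subseteq> UNIV} \<subseteq> \<Union> ?S"
    by (rule Union_upper)
  moreover have "\<phi> ` T \<subseteq> {f. continuous_on D f \<and> f ` D \<subseteq> E \<and> f ` {} \<subseteq> UNIV}"
    using maps continuous_on_slice[OF cont] by auto
  ultimately show "\<phi> ` topspace (top_of_set T) \<subseteq> \<Union> ?S"
    by (simp only: topspace_euclidean_subtopology)
qed

lemma holomorphic_semigroup_proj_act:
  fixes R :: "real \<Rightarrow> complex ^ ('n::finite) option ^ 'n option"
  assumes cont: "\<And>a b. continuous_on UNIV (\<lambda>t. R t $ a $ b)" and "R 0 = mat 1"
    and "\<And>s t. R (s + t) = R s ** R t" and pres: "\<And>t. preserves_form (R t)"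
  shows "holomorphic_semigroup (ball 0 1) (\<lambda>t. proj_act (R t))"
proof -
  have self: "proj_act (R t) \<in> holomorphic_self_maps (ball 0 1)" for t
    using holomorphic_map_on_proj_act[OF pres] proj_act_ball(2)[OF pres]
    by (auto simp: holomorphic_self_maps_def)
  have "continuous_on ({0..} \<times> ball 0 1) (\<lambda>(t, z). proj_act (R t) z)"
  proof -
    have "continuous_on ({0..} \<times> ball 0 1) (\<lambda>x. R (fst x) $ a $ b)" for a b
      using continuous_on_compose2[OF cont] continuous_on_fst[OF continuous_on_id] by blast
    moreover have "continuous_on ({0..} \<times> ball 0 1) (\<lambda>x. snd x $ k)" for k
      by (intro continuous_intros)
    ultimately have "continuous_on ({0..} \<times> ball 0 1) (\<lambda>x. (R (fst x) *v homogenize (snd x)) $ i)" for i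
      unfolding matrix_homogenize_nth by (intro continuous_on_add continuous_on_sum continuous_on_mult)
    moreover have "(R (fst x) *v homogenize (snd x)) $ None \<noteq> 0" if "x \<in> {0..} \<times> ball 0 1" for x
      using proj_act_ball(1)[OF pres] that by auto
    ultimately show ?thesis
      unfolding case_prod_unfold proj_act_def dehomogenize_def
      by (intro continuous_on_vec_lambda continuous_on_divide) auto
  qed
  then have "continuous_map (top_of_set {0..}) (compact_open_topology (ball 0 1) (ball 0 1)) (\<lambda>t. proj_act (R t))"
    using proj_act_ball(2)[OF pres] by (intro continuous_map_compact_open) auto
  then show ?thesis
    using self assms proj_act_mult[OF pres]
    by (auto simp: holomorphic_semigroup_def continuous_map_in_subtopology)
qed

section \<open>Automorphisms of the ball\<close>

definition cdot :: "complex ^ 'n \<Rightarrow> complex ^ 'n \<Rightarrow> complex" where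
  "cdot z w = (\<Sum>i\<in>UNIV. z $ i * cnj (w $ i))"

lemma cdot_self: "cdot z z = of_real ((norm z)\<^sup>2)"
  by (simp add: cdot_def norm_vec_power2 complex_norm_square del: of_real_power)

lemma cnj_cdot: "cnj (cdot z w) = cdot w z"
  by (simp add: cdot_def mult.commute)

lemma cdot_scale: "cdot (c *s z) w = c * cdot z w" "cdot z (c *s w) = cnj c * cdot z w"
  by (simp_all add: cdot_def sum_distrib_left mult_ac)

lemma cdot_diff: "cdot (x - y) w = cdot x w - cdot y w" "cdot w (x - y) = cdot w x - cdot w y"
  by (simp_all add: cdot_def left_diff_distrib right_diff_distrib sum_subtractf)

lemma norm_complex_scale: "norm (c *s z) = cmod c * norm z" for z :: "complex ^ 'n"
proof -
  have "complex_of_real ((norm (c *s z))\<^sup>2) = of_real ((cmod c * norm z)\<^sup>2)"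
    unfolding cdot_self[symmetric] cdot_scale power_mult_distrib of_real_mult complex_norm_square
    by (simp only: mult_ac)
  then have "(norm (c *s z))\<^sup>2 = (cmod c * norm z)\<^sup>2" by (simp only: of_real_eq_iff)
  then show ?thesis by (rule power2_eq_imp_eq) simp_all
qed

lemma norm_cdot_le: "cmod (cdot z w) \<le> norm z * norm w"
proof -
  have "cmod (cdot z w) \<le> (\<Sum>i\<in>UNIV. \<bar>norm (z $ i)\<bar> * \<bar>norm (w $ i)\<bar>)"
    unfolding cdot_def by (rule sum_norm_le) (simp add: norm_mult)
  also have "\<dots> \<le> norm z * norm w"
    unfolding norm_vec_def by (rule L2_set_mult_ineq)
  finally show ?thesis .
qed

text \<open>The equality case of Cauchy-Schwarz: expanding the squared norm of
  \<open>x - c *s w\<close> gives 0.\<close>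

lemma cdot_eq_imp_scale:
  assumes "norm w = 1" "norm x = cmod c" "cdot x w = c"
  shows "x = c *s w"
proof -
  have "cdot w x = cnj c" using cnj_cdot[of x w] assms by simp
  moreover have "cdot x x = c * cnj c" by (simp add: cdot_self assms complex_norm_square del: of_real_power)
  moreover have "cdot w w = 1" by (simp add: cdot_self assms)
  ultimately have "cdot (x - c *s w) (x - c *s w) = 0"
    using assms by (simp add: cdot_diff cdot_scale)
  then show ?thesis by (simp add: cdot_self)
qed

section \<open>The Schwarz lemma on complex lines\<close>

lemma slice_has_derivative: "((\<lambda>c. c *s u) has_derivative (\<lambda>k. k *s u)) (at c)" for u :: "complex ^ 'n"
  by (rule has_derivative_vecI) (auto intro!: derivative_eq_intros)

lemma slice_holomorphic:
  fixes g :: "complex ^ 'n \<Rightarrow> complex ^ 'm"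
  assumes "holomorphic_map_on g (ball 0 1)" "norm u = 1"
  shows "(\<lambda>c. cdot (g (c *s u)) w) holomorphic_on ball 0 1"
proof (rule holomorphic_onI)
  fix c :: complex assume "c \<in> ball 0 1"
  then have "c *s u \<in> ball 0 1" using assms(2) by (simp add: norm_complex_scale)
  then obtain g' where g': "Vector_Spaces.linear (*s) (*s) g'" "(g has_derivative g') (at (c *s u))"
    using assms(1) unfolding holomorphic_map_on_def by blast
  interpret g': Vector_Spaces.linear "(*s)" "(*s)" g' by (rule g'(1))
  have "((\<lambda>c. g (c *s u)) has_derivative (\<lambda>k. g' (k *s u))) (at c)"
    using diff_chain_at[OF slice_has_derivative[of u c] g'(2)] by (simp add: o_def)
  then have "((\<lambda>c. g (c *s u) $ i) has_derivative (\<lambda>k. g' (k *s u) $ i)) (at c)" for i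
    by (rule bounded_linear.has_derivative[OF bounded_linear_vec_nth])
  then have "((\<lambda>c. cdot (g (c *s u)) w) has_derivative (\<lambda>k. cdot (g' (k *s u)) w)) (at c)"
    unfolding cdot_def by (intro has_derivative_sum has_derivative_mult_left)
  \<comment> \<open>Complex linearity turns the real derivative into multiplication by a complex
    number.\<close>
  moreover have "(\<lambda>k. cdot (g' (k *s u)) w) = (*) (cdot (g' u) w)"
    by (simp add: g'.scale cdot_scale mult.commute fun_eq_iff)
  ultimately have "((\<lambda>c. cdot (g (c *s u)) w) has_field_derivative cdot (g' u) w) (at c)"
    by (simp add: has_field_derivative_def)
  then show "(\<lambda>c. cdot (g (c *s u)) w) field_differentiable at c within ball 0 1"
    using field_differentiable_at_within field_differentiable_def by blast
qed

lemma slice_less_1: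
  fixes g :: "complex ^ 'n \<Rightarrow> complex ^ 'm"
  assumes "g ` ball 0 1 \<subseteq> ball 0 1" "norm u = 1" "norm w = 1" "cmod c < 1"
  shows "cmod (cdot (g (c *s u)) w) < 1"
proof -
  have "c *s u \<in> ball 0 1" using assms by (simp add: norm_complex_scale)
  then have "g (c *s u) \<in> ball 0 1" using assms(1) by blast
  then show ?thesis using norm_cdot_le[of "g (c *s u)" w] assms(3) by simp
qed

text \<open>The one-variable Schwarz lemma is applied on the line through \<open>z\<close>, paired
  with the unit vector along \<open>g z\<close>; at \<open>z\<close> the pairing is exactly
  \<open>norm (g z)\<close>.\<close>

lemma holomorphic_contraction:
  fixes g :: "complex ^ 'n \<Rightarrow> complex ^ 'm"
  assumes "holomorphic_map_on g (ball 0 1)" "g ` ball 0 1 \<subseteq> ball 0 1" "g 0 = 0" "z \<in> ball 0 1"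
  shows "norm (g z) \<le> norm z"
proof (cases "z = 0 \<or> g z = 0")
  case True
  then show ?thesis using assms by auto
next
  case False
  define u where "u = complex_of_real (1 / norm z) *s z"
  define w where "w = complex_of_real (1 / norm (g z)) *s g z"
  have u: "norm u = 1" "of_real (norm z) *s u = z"
    using False by (simp_all add: u_def norm_complex_scale norm_divide)
  have w: "norm w = 1" "cdot (g z) w = of_real (norm (g z))"
    using False by (simp_all add: w_def norm_complex_scale norm_divide cdot_scale cdot_self power2_eq_square)
  have "cmod (cdot (g (of_real (norm z) *s u)) w) \<le> cmod (of_real (norm z))"
    by (rule Schwarz_Lemma(1)[OF slice_holomorphic[OF assms(1) u(1)] _ slice_less_1[OF assms(2) u(1) w(1)]])
      (use assms in \<open>simp_all add: cdot_def\<close>)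
  then show ?thesis using u w by simp
qed

text \<open>The equality case of the Schwarz lemma for \<open>c \<mapsto> \<langle>g (c u), w\<rangle>\<close>, where \<open>w = 2 g (u / 2)\<close>.\<close>

lemma norm_preserving_slice:
  fixes g :: "complex ^ 'n \<Rightarrow> complex ^ 'm"
  assumes "holomorphic_map_on g (ball 0 1)" "g ` ball 0 1 \<subseteq> ball 0 1" "g 0 = 0"
    and iso: "\<And>z. z \<in> ball 0 1 \<Longrightarrow> norm (g z) = norm z" and u: "norm u = 1"
  shows "\<exists>w. norm w = 1 \<and> (\<forall>c. cmod c < 1 \<longrightarrow> g (c *s u) = c *s w)"
proof -
  have ball: "c *s u \<in> ball 0 1" if "cmod c < 1" for c using that u by (simp add: norm_complex_scale)
  define w where "w = 2 *s g ((1/2) *s u)"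
  have n: "norm (g ((1/2) *s u)) = 1/2"
    using iso[OF ball, of "1/2"] u by (simp add: norm_complex_scale)
  have w: "norm w = 1" by (simp add: w_def norm_complex_scale n)
  let ?h = "\<lambda>c. cdot (g (c *s u)) w"
  have half: "?h (1/2) = 1/2"
    by (simp add: w_def cdot_scale cdot_self n power2_eq_square)
  have "\<exists>a. (\<forall>c. cmod c < 1 \<longrightarrow> ?h c = a * c) \<and> cmod a = 1"
  proof (rule Schwarz_Lemma(3)[OF slice_holomorphic[OF assms(1) u] _ slice_less_1[OF assms(2) u w], of 0])
    show "(\<exists>c. cmod c < 1 \<and> c \<noteq> 0 \<and> cmod (?h c) = cmod c) \<or> cmod (deriv ?h 0) = 1"
      by (intro disjI1 exI[of _ "1/2"]) (simp only: half, simp)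
  qed (use assms(3) in \<open>simp_all add: cdot_def\<close>)
  then obtain a where a: "\<And>c. cmod c < 1 \<Longrightarrow> ?h c = a * c" by blast
  have "a = 1" using a[of "1/2"] half by simp
  then have "g (c *s u) = c *s w" if "cmod c < 1" for c
    using a[OF that] iso[OF ball[OF that]] u w
    by (intro cdot_eq_imp_scale) (simp_all add: norm_complex_scale)
  then show ?thesis using w by blast
qed

text \<open>On each complex line through 0 the map is linear, and differentiating at 0 identifies
  its slope with the value of the derivative \<open>G\<close>. Hence \<open>g\<close> agrees with
  \<open>G\<close> on the whole ball.\<close>

lemma norm_preserving_linear:
  fixes g :: "complex ^ 'n \<Rightarrow> complex ^ 'm"
  assumes "holomorphic_map_on g (ball 0 1)" "g ` ball 0 1 \<subseteq> ball 0 1" "g 0 = 0"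
    and iso: "\<And>z. z \<in> ball 0 1 \<Longrightarrow> norm (g z) = norm z"
  shows "\<exists>A. (\<forall>z\<in>ball 0 1. g z = A *v z) \<and> (\<forall>v. norm (A *v v) = norm v)"
proof -
  obtain G where G: "Vector_Spaces.linear (*s) (*s) G" "(g has_derivative G) (at 0)"
    using assms(1) unfolding holomorphic_map_on_def by fastforce
  interpret G: Vector_Spaces.linear "(*s)" "(*s)" G by (rule G(1))
  have slice: "\<exists>w. norm w = 1 \<and> (\<forall>c. cmod c < 1 \<longrightarrow> g (c *s u) = c *s w) \<and> (\<forall>k. G (k *s u) = k *s w)"
    if u: "norm u = 1" for u
  proof -
    obtain w where w: "norm w = 1" "\<And>c. cmod c < 1 \<Longrightarrow> g (c *s u) = c *s w"
      using norm_preserving_slice[OF assms u] by blast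
    have "(g has_derivative G) (at (0 *s u))" using G(2) by simp
    then have "((\<lambda>c. g (c *s u)) has_derivative (\<lambda>k. G (k *s u))) (at 0)"
      using diff_chain_at[OF slice_has_derivative[of u 0]] by (simp add: o_def)
    then have "((\<lambda>c. c *s w) has_derivative (\<lambda>k. G (k *s u))) (at 0)"
      by (rule has_derivative_transform_within_open[of _ _ _ _ "ball 0 1"]) (use w in auto)
    then have "(\<lambda>k. G (k *s u)) = (\<lambda>k. k *s w)"
      using slice_has_derivative has_derivative_unique by blast
    then show ?thesis using w by metis
  qed
  have unit: "\<exists>u. norm u = 1 \<and> v = of_real (norm v) *s u" if "v \<noteq> 0" for v :: "complex ^ 'n"
    using that by (intro exI[of _ "complex_of_real (1 / norm v) *s v"])
      (simp add: norm_complex_scale norm_divide)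
  have "g z = matrix G *v z" if z: "z \<in> ball 0 1" for z
  proof (cases "z = 0")
    case False
    then obtain u where u: "norm u = 1" "z = of_real (norm z) *s u" using unit by blast
    moreover have "cmod (of_real (norm z)) < 1" using z by simp
    ultimately have "g z = G z" using slice[OF u(1)] by metis
    then show ?thesis by (simp add: matrix_works[OF G(1)])
  qed (simp add: assms(3))
  moreover have "norm (matrix G *v v) = norm v" for v
  proof (cases "v = 0")
    case False
    then obtain u where u: "norm u = 1" "v = of_real (norm v) *s u" using unit by blast
    then obtain w where "norm w = 1" "G v = of_real (norm v) *s w" using slice[OF u(1)] by metis
    then show ?thesis by (simp add: matrix_works[OF G(1)] norm_complex_scale)
  qed simp
  ultimately show ?thesis by blast
qed

section \<open>Matrices realizing the automorphisms\<close>

lemma lorentz_form_cdot: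
  "lorentz_form v w = v $ None * cnj (w $ None) - cdot (\<chi> i. v $ Some i) (\<chi> i. w $ Some i)"
  by (simp add: lorentz_form_def cdot_def)

lemma lorentz_form_add:
  "lorentz_form (u + v) w = lorentz_form u w + lorentz_form v w"
  "lorentz_form w (u + v) = lorentz_form w u + lorentz_form w v"
  by (simp_all add: lorentz_form_def sum.distrib algebra_simps)

lemma lorentz_form_scale_left: "lorentz_form (c *s v) w = c * lorentz_form v w"
  by (simp add: lorentz_form_def sum_distrib_left algebra_simps)

lemma lorentz_form_scale_right: "lorentz_form v (c *s w) = cnj c * lorentz_form v w"
  by (simp add: lorentz_form_def sum_distrib_left algebra_simps)

text \<open>Polarization: the defect \<open>d\<close> vanishes on the diagonal, so
  \<open>d v w + d w v = 0\<close>; replacing \<open>v\<close> by \<open>\<i> *s v\<close> gives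
  \<open>d v w = d w v\<close> as well.\<close>

lemma preserves_formI:
  assumes q: "\<And>v. lorentz_form (M *v v) (M *v v) = lorentz_form v v"
  shows "preserves_form M"
  unfolding preserves_form_def
proof (intro allI)
  fix v w
  define d where "d v w = lorentz_form (M *v v) (M *v w) - lorentz_form v w" for v w
  have skew: "d v w + d w v = 0" for v w
    using q[of "v + w"] q[of v] q[of w]
    by (simp add: d_def lorentz_form_add matrix_vector_right_distrib algebra_simps)
  have "d (\<i> *s v) w = \<i> * d v w" "d w (\<i> *s v) = - \<i> * d w v"
    by (simp_all add: d_def lorentz_form_scale_left lorentz_form_scale_right vector_scalar_commute algebra_simps)
  then have "\<i> * (d v w - d w v) = 0"
    using skew[of "\<i> *s v" w] by (simp add: algebra_simps)
  then have "d v w = 0" using skew[of v w] by simp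
  then show "lorentz_form (M *v v) (M *v w) = lorentz_form v w" by (simp add: d_def)
qed

text \<open>The form is nondegenerate: pairing a kernel vector with the coordinate axes shows that
  all its coordinates vanish.\<close>

lemma preserves_form_left_inverse:
  fixes M :: "complex ^ ('n::finite) option ^ 'n option"
  assumes "preserves_form M"
  shows "\<exists>N. N ** M = mat 1"
  unfolding matrix_left_invertible_ker
proof (intro allI impI)
  fix v assume "M *v v = 0"
  then have 0: "lorentz_form v w = 0" for w
    using assms unfolding preserves_form_def by (metis lorentz_form_scale_left mult_zero_left vec.scale_zero_left)
  have "v $ None = 0" "v $ Some j = 0" for j
    using 0[of "axis None 1"] 0[of "axis (Some j) 1"]
    by (auto simp: lorentz_form_def axis_def if_distrib cong: if_cong)
  then have "v $ i = 0" for i by (cases i) auto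
  then show "v = 0" by (simp add: vec_eq_iff)
qed

text \<open>The witness is block diagonal, with entry 1 at \<open>None\<close> and block
  \<open>A\<close>.\<close>

lemma isometry_proj_act:
  fixes A :: "complex ^ 'n ^ 'n"
  assumes "\<And>v. norm (A *v v) = norm v"
  shows "\<exists>U. preserves_form U \<and> (\<forall>z. proj_act U z = A *v z)"
proof -
  define F where "F v = (\<chi> i. case i of None \<Rightarrow> v $ None | Some j \<Rightarrow> (A *v (\<chi> k. v $ Some k)) $ j)"
    for v :: "complex ^ 'n option"
  have F: "F v $ None = v $ None" "(\<chi> k. F v $ Some k) = A *v (\<chi> k. v $ Some k)" for v
    by (simp_all add: F_def vec_eq_iff)
  have "Vector_Spaces.linear (*s) (*s) F"
    by unfold_locales
      (auto simp: F_def vec_eq_iff matrix_vector_mult_def sum.distrib sum_distrib_left algebra_simps split: option.split)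
  then have U: "matrix F *v v = F v" for v by (rule matrix_works)
  have "preserves_form (matrix F)"
    by (rule preserves_formI) (simp only: U lorentz_form_cdot F cdot_self assms)
  moreover have "proj_act (matrix F) z = A *v z" for z
  proof -
    have "(\<chi> k. homogenize z $ Some k) = z" by (simp add: vec_eq_iff)
    then show ?thesis by (simp add: proj_act_def U F_def vec_eq_iff)
  qed
  ultimately show ?thesis by blast
qed

text \<open>The involution \<open>z \<mapsto> (a - P z - s Q z) / (1 - \<langle>z, a\<rangle>)\<close> with \<open>s = sqrt (1 - \<bar>a\<bar>\<^sup>2)\<close>, \<open>P\<close> the
  projection onto the span of \<open>a\<close>, and \<open>Q = 1 - P\<close>.  Since \<open>(1 - s) / \<bar>a\<bar>\<^sup>2 = 1 / (1 + s)\<close>,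
  \<open>P z + s Q z = s z + \<langle>z, a\<rangle> a / (1 + s)\<close>, which also makes sense for \<open>a = 0\<close>.\<close>

lemma ball_involution:
  fixes a :: "complex ^ 'n"
  assumes "a \<in> ball 0 1"
  shows "\<exists>A. preserves_form A \<and> A ** A = mat 1 \<and> proj_act A a = 0"
proof -
  define s where "s = complex_of_real (sqrt (1 - (norm a)\<^sup>2))"
  have pos: "0 < 1 - (norm a)\<^sup>2" using assms by (simp add: abs_square_less_1)
  have s0: "s \<noteq> 0" using pos by (simp add: s_def)
  have s1: "1 + s \<noteq> 0"
    unfolding s_def using pos
    by (metis add.commute add_pos_pos of_real_1 of_real_add of_real_eq_0_iff order_less_irrefl real_sqrt_gt_zero zero_less_one)
  have cs: "cnj s = s" by (simp add: s_def)
  have ss: "s * s = 1 - cdot a a"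
  proof -
    have "s * s = complex_of_real (sqrt (1 - (norm a)\<^sup>2) * sqrt (1 - (norm a)\<^sup>2))"
      by (simp only: s_def of_real_mult)
    also have "\<dots> = 1 - cdot a a" using pos by (simp add: cdot_self)
    finally show ?thesis .
  qed
  define k where "k v = cdot (\<chi> i. v $ Some i) a / (1 + s)" for v :: "complex ^ 'n option"
  \<comment> \<open>Denominator and numerator of the involution in homogeneous coordinates, both
    divided by \<open>s\<close>. Without this division the form would be multiplied by
    \<open>s * s\<close>, and the square of the map would be \<open>s * s\<close> times the
    identity.\<close>
  define F where "F v = (\<chi> i. case i of None \<Rightarrow> (v $ None - (1 + s) * k v) / s
      | Some j \<Rightarrow> ((v $ None - k v) * a $ j - s * v $ Some j) / s)" for v :: "complex ^ 'n option"
  have F: "F v $ None = (v $ None - (1 + s) * k v) / s"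
    "(\<chi> i. F v $ Some i) = (1 / s) *s ((v $ None - k v) *s a - s *s (\<chi> i. v $ Some i))" for v
    by (simp_all add: F_def vec_eq_iff diff_divide_distrib left_diff_distrib)
  have ck: "cdot (\<chi> i. v $ Some i) a = (1 + s) * k v" for v
    using s1 by (simp add: k_def)
  have ck': "cdot a (\<chi> i. v $ Some i) = (1 + s) * cnj (k v)" for v
    using cnj_cdot[of "\<chi> i. v $ Some i" a] by (simp add: ck cs)
  have kadd: "k (u + v) = k u + k v" for u v
    by (simp add: k_def cdot_def sum.distrib distrib_right add_divide_distrib)
  have kscale: "k (c *s v) = c * k v" for c v
    by (simp add: k_def cdot_def sum_distrib_left mult.assoc)
  have "Vector_Spaces.linear (*s) (*s) F"
  proof unfold_locales
    show "F (u + v) = F u + F v" for u v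
      using s0 by (auto simp: F_def vec_eq_iff kadd field_simps split: option.split)
    show "F (c *s v) = c *s F v" for c v
      using s0 by (auto simp: F_def vec_eq_iff kscale field_simps split: option.split)
  qed
  then have A: "matrix F *v v = F v" for v by (rule matrix_works)
  have aa: "cdot a a = 1 - s * s" using ss by simp
  have form: "lorentz_form (F v) (F v) = lorentz_form v v" for v
  proof -
    let ?o = "v $ None" and ?z = "\<chi> i. v $ Some i"
    let ?b = "?o - k v"
    have "s * s * lorentz_form (F v) (F v) = (?o - (1 + s) * k v) * cnj (?o - (1 + s) * k v) -
      cdot (?b *s a - s *s ?z) (?b *s a - s *s ?z)"
      unfolding lorentz_form_cdot F cdot_scale using s0 by (simp add: cs field_simps)
    also have "cdot (?b *s a - s *s ?z) (?b *s a - s *s ?z) =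
      ?b * cnj ?b * (1 - s * s) - s * ?b * ((1 + s) * cnj (k v)) - s * cnj ?b * ((1 + s) * k v) + s * s * cdot ?z ?z"
      by (simp only: cdot_diff cdot_scale ck ck' cs aa) (simp only: algebra_simps)
    also have "(?o - (1 + s) * k v) * cnj (?o - (1 + s) * k v) - \<dots> = s * s * lorentz_form v v"
      unfolding lorentz_form_cdot by (simp add: cs algebra_simps)
    finally show ?thesis using s0 by simp
  qed
  have pres: "preserves_form (matrix F)"
    by (rule preserves_formI) (simp only: A form)
  have kF: "s * k (F v) = (1 - s) * v $ None - k v" for v
  proof -
    have "s * (1 + s) * k (F v) = s * cdot (\<chi> i. F v $ Some i) a"
      by (simp add: ck)
    also have "\<dots> = (v $ None - k v) * (1 - s * s) - s * ((1 + s) * k v)"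
      unfolding F cdot_scale cdot_diff ck aa using s0 by simp
    also have "\<dots> = (1 + s) * ((1 - s) * v $ None - k v)"
      by (simp add: algebra_simps)
    finally have "(1 + s) * (s * k (F v)) = (1 + s) * ((1 - s) * v $ None - k v)"
      by (simp only: mult_ac)
    then show ?thesis using s1 by (simp only: mult_cancel_left) simp
  qed
  have n: "s * F v $ None = v $ None - (1 + s) * k v" for v using s0 by (simp add: F)
  have FF: "F (F v) = v" for v
  proof -
    have "s * (s * F (F v) $ None) = s * F v $ None - (1 + s) * (s * k (F v))"
      by (simp only: n[of "F v"] right_diff_distrib mult.left_commute)
    also have "\<dots> = s * (s * v $ None)"
      unfolding n[of v] kF by (simp add: algebra_simps)
    finally have N: "F (F v) $ None = v $ None" using s0 by simp
    \<comment> \<open>The coefficient of \<open>a\<close> is invariant under \<open>F\<close>, so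
      the two multiples of \<open>a\<close> cancel in \<open>F (F v)\<close>.\<close>
    have b: "F v $ None - k (F v) = v $ None - k v"
    proof -
      have "s * (F v $ None - k (F v)) = s * (v $ None - k v)"
        unfolding right_diff_distrib n[of v] kF by (simp add: algebra_simps)
      then show ?thesis using s0 by simp
    qed
    have "F (F v) $ Some j = v $ Some j" for j
    proof -
      have "s * F (F v) $ Some j = (F v $ None - k (F v)) * a $ j - s * F v $ Some j"
        using s0 by (simp add: F_def[of "F v"])
      also have "s * F v $ Some j = (v $ None - k v) * a $ j - s * v $ Some j"
        using s0 by (simp add: F_def[of v])
      finally show ?thesis using s0 unfolding b by simp
    qed
    with N have "F (F v) $ i = v $ i" for i by (cases i) auto
    then show ?thesis by (simp add: vec_eq_iff)
  qed
  have "matrix F ** matrix F = mat 1"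
    by (simp add: matrix_eq A FF flip: matrix_vector_mul_assoc)
  moreover have "proj_act (matrix F) a = 0"
  proof -
    have h: "(\<chi> i. homogenize a $ Some i) = a" by (simp add: vec_eq_iff)
    have "(1 + s) * k (homogenize a) = (1 + s) * (1 - s)"
      using ck[of "homogenize a"] unfolding h aa by (simp add: algebra_simps)
    then have "k (homogenize a) = 1 - s" using s1 by (simp only: mult_cancel_left) simp
    then show ?thesis by (simp add: proj_act_def A F_def vec_eq_iff)
  qed
  ultimately show ?thesis using pres by blast
qed

text \<open>Both \<open>g\<close> and its left inverse \<open>h\<close> fix 0 and are contractions,
  so \<open>g\<close> preserves norms and is therefore linear.\<close>

lemma ball_automorphism_fixing_0:
  fixes g :: "complex ^ 'n \<Rightarrow> complex ^ 'n"
  assumes "holomorphic_map_on g (ball 0 1)" "g ` ball 0 1 \<subseteq> ball 0 1"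
    and "holomorphic_map_on h (ball 0 1)" "h ` ball 0 1 \<subseteq> ball 0 1"
    and "\<And>z. z \<in> ball 0 1 \<Longrightarrow> h (g z) = z" and "g 0 = 0"
  shows "\<exists>U. preserves_form U \<and> (\<forall>z\<in>ball 0 1. g z = proj_act U z)"
proof -
  have "h 0 = 0" using assms(5)[of 0] assms(6) by simp
  then have "norm (g z) = norm z" if "z \<in> ball 0 1" for z
    using that holomorphic_contraction[OF assms(1,2,6) that]
      holomorphic_contraction[OF assms(3,4), of "g z"] assms(2,5) by fastforce
  then obtain A where A: "\<forall>z\<in>ball 0 1. g z = A *v z" "\<And>v. norm (A *v v) = norm v"
    using norm_preserving_linear[OF assms(1,2,6)] by blast
  then show ?thesis using isometry_proj_act[OF A(2)] by metis
qed

lemma ball_automorphism_proj_act: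
  fixes f :: "complex ^ 'n \<Rightarrow> complex ^ 'n"
  assumes "holomorphic_automorphism (ball 0 1) f"
  shows "\<exists>M. preserves_form M \<and> (\<forall>z\<in>ball 0 1. f z = proj_act M z)"
proof -
  let ?B = "ball 0 1 :: (complex ^ 'n) set"
  let ?h = "inv_into ?B f"
  have f: "holomorphic_map_on f ?B" "bij_betw f ?B ?B" "holomorphic_map_on ?h ?B"
    using assms by (auto simp: holomorphic_automorphism_def)
  have fB: "f ` ?B = ?B" and hB: "?h ` ?B = ?B"
    using f(2) bij_betw_inv_into[OF f(2)] by (simp_all add: bij_betw_def)
  have "f 0 \<in> ?B" using fB by auto
  then obtain A where A: "preserves_form A" "A ** A = mat 1" "proj_act A (f 0) = 0"
    using ball_involution by blast
  have AB: "proj_act A ` ?B \<subseteq> ?B" using proj_act_ball(2)[OF A(1)] by blast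
  have AA: "proj_act A (proj_act A z) = z" if "z \<in> ?B" for z
    using proj_act_mult[OF A(1) that, of A] A(2) by simp
  have fz: "f z \<in> ?B" if "z \<in> ?B" for z using that fB by blast
  have "\<exists>U. preserves_form U \<and> (\<forall>z\<in>?B. (proj_act A \<circ> f) z = proj_act U z)"
  proof (rule ball_automorphism_fixing_0[of _ "?h \<circ> proj_act A"])
    show "holomorphic_map_on (proj_act A \<circ> f) ?B"
      using f(1) holomorphic_map_on_proj_act[OF A(1)] fB by (intro holomorphic_map_on_compose) auto
    show "holomorphic_map_on (?h \<circ> proj_act A) ?B"
      using f(3) holomorphic_map_on_proj_act[OF A(1)] AB by (intro holomorphic_map_on_compose) auto
    show "(proj_act A \<circ> f) ` ?B \<subseteq> ?B" using fB AB by (metis image_comp)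
    show "(?h \<circ> proj_act A) ` ?B \<subseteq> ?B" using hB AB by (metis image_comp image_mono)
    show "(?h \<circ> proj_act A) ((proj_act A \<circ> f) z) = z" if "z \<in> ?B" for z
      using AA[OF fz[OF that]] bij_betw_inv_into_left[OF f(2) that] by simp
  qed (use A(3) in simp)
  then obtain U where U: "preserves_form U" "\<And>z. z \<in> ?B \<Longrightarrow> proj_act A (f z) = proj_act U z"
    by auto
  \<comment> \<open>The involution is its own inverse, so it can be moved to the other side.\<close>
  have "f z = proj_act (A ** U) z" if "z \<in> ?B" for z
    using AA[OF fz[OF that]] U(2)[OF that] proj_act_mult[OF U(1) that, of A] by simp
  then show ?thesis using preserves_form_mult[OF A(1) U(1)] by blast
qed

theorem corollary1p10:
  fixes f :: "complex ^ 'n \<Rightarrow> complex ^ 'n"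
  assumes "holomorphic_automorphism (ball 0 1) f"
  shows "\<exists>\<phi>. holomorphic_semigroup (ball 0 1) \<phi> \<and>
    (\<forall>t\<ge>0. holomorphic_automorphism (ball 0 1) (\<phi> t)) \<and>
    (\<forall>z\<in>ball 0 1. \<phi> 1 z = f z)"
proof -
  obtain M where M: "preserves_form M" "\<forall>z\<in>ball 0 1. f z = proj_act M z"
    using ball_automorphism_proj_act[OF assms] by blast
  obtain N where "N ** M = mat 1" using preserves_form_left_inverse[OF M(1)] by blast
  from one_parameter_group[OF this M(1)] obtain R :: "real \<Rightarrow> _" where
    "(\<forall>a b. continuous_on UNIV (\<lambda>t. R t $ a $ b)) \<and> R 0 = mat 1 \<and> R 1 = M \<and>
     (\<forall>s t. R (s + t) = R s ** R t) \<and> (\<forall>t. preserves_form (R t))" ..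
  then have R: "\<And>a b. continuous_on UNIV (\<lambda>t. R t $ a $ b)" "R 0 = mat 1" "R 1 = M"
    "\<And>s t. R (s + t) = R s ** R t" "\<And>t. preserves_form (R t)"
    by simp_all
  \<comment> \<open>Negative exponents provide the inverse automorphisms.\<close>
  have "R t ** R (- t) = mat 1" "R (- t) ** R t = mat 1" for t
    using R(4)[of t "- t", symmetric] R(4)[of "- t" t, symmetric] R(2) by simp_all
  then have "holomorphic_automorphism (ball 0 1) (proj_act (R t))" for t
    using holomorphic_automorphism_proj_act R(5) by blast
  moreover have "holomorphic_semigroup (ball 0 1) (\<lambda>t. proj_act (R t))"
    by (rule holomorphic_semigroup_proj_act[OF R(1,2,4,5)])
  ultimately show ?thesis using M(2) R(3) by (intro exI[of _ "\<lambda>t. proj_act (R t)"]) simp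
qed

end
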